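(* Any reflexive simplex $\Delta$ is selfdual.
   Context: Let $M$ be a free abelian group of rank $n$, $N=\mathrm{Hom}(M,\mathbf{Z})$. A pair $(\Delta,M)$ is reflexive if $\Delta\subset M_{\mathbf{Q}}$ is an $n$-dimensional convex polytope with vertices in $M$ and $0$ in its interior such that each affine hyperplane spanned by an $(n-1)$-dimensional face is $\{x:\langle x,l\rangle=c\}$ with $l\in N$ primitive and $|c|=1$; then $\Delta$ is a reflexive polyhedron, and a reflexive simplex is a reflexive polyhedron which is an $n$-dimensional simplex. The dual is $\Delta^*=\{y\in N_{\mathbf{Q}}:\langle x,y\rangle\ge-1\ \forall x\in\Delta\}$, and $(\Delta^*,N)$ is again reflexive. A finite morphism $(\Delta_1,M_1)\to(\Delta_2,M_2)$ of reflexive pairs of equal dimension is a lattice homomorphism $\phi:M_1\to M_2$ with $\phi(\Delta_1)=\Delta_2$; an isomorphism is one with $\phi$ an isomorphism of lattices. Let $M^\Delta=\{m\in M_{\mathbf{Q}}:\langle m,l\rangle\in\mathbf{Z}\text{ for all vertices } l\text{ of }\Delta^*\}\supset M$ (the dual of the sublattice of $N$ generated by the vertices of $\Delta^*$) and $N^{\Delta^*}=\{y\in N_{\mathbf{Q}}:\langle p,y\rangle\in\mathbf{Z}\text{ for all vertices }p\text{ of }\Delta\}\supset N$. The pairs $(\Delta,M^\Delta)$ and $(\Delta^*,N^{\Delta^*})$ are reflexive and are the maximal reflexive pairs associated with $(\Delta,M)$ and $(\Delta^*,N)$. $\Delta$ is called selfdual if there exists an isomorphism of reflexive pairs $(\Delta,M^\Delta)\to(\Delta^*,N^{\Delta^*})$.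 *)

theory Defs
  imports "HOL-Analysis.Analysis"
begin

text \<open>
  A lattice \<open>M\<close> of rank \<open>n\<close> is a full-rank lattice in a Euclidean space of
  dimension \<open>n\<close>. The whole space plays the role of \<open>M \<otimes> \<real>\<close>, and
  \<open>M \<otimes> \<rat>\<close> is the subset \<open>rational_span M\<close>. The inner product identifies
  the space with its dual, and thereby the homomorphisms \<open>M \<rightarrow> \<int>\<close> with
  \<open>dual_lattice M\<close>. Polytopes are taken over the reals; since their vertices lie
  in a lattice, this is the same as working with polytopes over the rationals.
\<close>

definition full_lattice :: "'a::euclidean_space set \<Rightarrow> bool" where
  "full_lattice M \<longleftrightarrow>
     (\<exists>B. independent B \<and> span B = UNIV \<and>
          M = {\<Sum>b\<in>B. real_of_int (c b) *\<^sub>R b | c :: 'a \<Rightarrow> int. True})"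

definition dual_lattice :: "'a::euclidean_space set \<Rightarrow> 'a set" where
  "dual_lattice M = {y. \<forall>x\<in>M. x \<bullet> y \<in> \<int>}"

definition rational_span :: "'a::euclidean_space set \<Rightarrow> 'a set" where
  "rational_span M = {x. \<exists>k::nat. k > 0 \<and> real k *\<^sub>R x \<in> M}"

definition primitive_in :: "'a::euclidean_space set \<Rightarrow> 'a \<Rightarrow> bool" where
  "primitive_in L v \<longleftrightarrow>
     v \<in> L \<and> v \<noteq> 0 \<and>
     (\<forall>u\<in>L. \<forall>k::int. v = real_of_int k *\<^sub>R u \<longrightarrow> \<bar>k\<bar> = 1)"

definition vertices :: "'a::euclidean_space set \<Rightarrow> 'a set" where
  "vertices P = {x. x extreme_point_of P}"

definition reflexive_pair :: "'a::euclidean_space set \<Rightarrow> 'a set \<Rightarrow> bool" where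
  "reflexive_pair \<Delta> M \<longleftrightarrow>
     full_lattice M \<and>
     polytope \<Delta> \<and> aff_dim \<Delta> = int DIM('a) \<and>
     vertices \<Delta> \<subseteq> M \<and> 0 \<in> interior \<Delta> \<and>
     (\<forall>F. F facet_of \<Delta> \<longrightarrow>
        (\<exists>l c. primitive_in (dual_lattice M) l \<and> \<bar>c\<bar> = 1 \<and>
               affine hull F = {x. x \<bullet> l = c}))"

definition reflexive_simplex :: "'a::euclidean_space set \<Rightarrow> 'a set \<Rightarrow> bool" where
  "reflexive_simplex \<Delta> M \<longleftrightarrow> reflexive_pair \<Delta> M \<and> int DIM('a) simplex \<Delta>"

definition dual_polytope :: "'a::euclidean_space set \<Rightarrow> 'a set" where
  "dual_polytope \<Delta> = {y. \<forall>x\<in>\<Delta>. x \<bullet> y \<ge> -1}"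

definition maximal_lattice :: "'a::euclidean_space set \<Rightarrow> 'a set \<Rightarrow> 'a set" where
  "maximal_lattice \<Delta> M =
     {m \<in> rational_span M. \<forall>l \<in> vertices (dual_polytope \<Delta>). m \<bullet> l \<in> \<int>}"

text \<open>The maximal lattice of the dual pair, defined by the vertices of \<open>\<Delta>\<close> itself
  rather than by those of the double dual.\<close>

definition maximal_dual_lattice :: "'a::euclidean_space set \<Rightarrow> 'a set \<Rightarrow> 'a set" where
  "maximal_dual_lattice \<Delta> M =
     {y \<in> rational_span (dual_lattice M). \<forall>p \<in> vertices \<Delta>. p \<bullet> y \<in> \<int>}"

text \<open>A homomorphism between full-rank lattices is represented by its unique
  linear extension to the ambient spaces.\<close>

definition finite_morphism ::
  "('a::euclidean_space \<Rightarrow> 'b::euclidean_space) \<Rightarrow>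
     'a set \<Rightarrow> 'a set \<Rightarrow> 'b set \<Rightarrow> 'b set \<Rightarrow> bool" where
  "finite_morphism \<phi> \<Delta>\<^sub>1 M\<^sub>1 \<Delta>\<^sub>2 M\<^sub>2 \<longleftrightarrow>
     reflexive_pair \<Delta>\<^sub>1 M\<^sub>1 \<and> reflexive_pair \<Delta>\<^sub>2 M\<^sub>2 \<and> DIM('a) = DIM('b) \<and>
     linear \<phi> \<and> \<phi> ` M\<^sub>1 \<subseteq> M\<^sub>2 \<and> \<phi> ` \<Delta>\<^sub>1 = \<Delta>\<^sub>2"

definition reflexive_isomorphism ::
  "('a::euclidean_space \<Rightarrow> 'b::euclidean_space) \<Rightarrow>
     'a set \<Rightarrow> 'a set \<Rightarrow> 'b set \<Rightarrow> 'b set \<Rightarrow> bool" where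
  "reflexive_isomorphism \<phi> \<Delta>\<^sub>1 M\<^sub>1 \<Delta>\<^sub>2 M\<^sub>2 \<longleftrightarrow>
     finite_morphism \<phi> \<Delta>\<^sub>1 M\<^sub>1 \<Delta>\<^sub>2 M\<^sub>2 \<and> bij_betw \<phi> M\<^sub>1 M\<^sub>2"

definition selfdual :: "'a::euclidean_space set \<Rightarrow> 'a set \<Rightarrow> bool" where
  "selfdual \<Delta> M \<longleftrightarrow>
     (\<exists>\<phi>. reflexive_isomorphism \<phi> \<Delta> (maximal_lattice \<Delta> M)
            (dual_polytope \<Delta>) (maximal_dual_lattice \<Delta> M))"

end

theory Submission imports Defs begin

text \<open>
  Let \<open>C\<close> be the vertex set of a reflexive simplex \<open>\<Delta>\<close>, and for \<open>p \<in> C\<close> let \<open>l p\<close> be the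
  normal of the facet opposite to \<open>p\<close>, scaled so that \<open>q \<bullet> l p = -1\<close> for the vertices \<open>q \<noteq> p\<close>.
  Let \<open>w p > 0\<close> be the barycentric coordinates of the origin: \<open>\<Sum> w p = 1\<close> and
  \<open>\<Sum> w p *\<^sub>R p = 0\<close>. Pairing the last relation with \<open>l p\<close> gives \<open>w p * (p \<bullet> l p) = 1 - w p\<close>.
  Hence the matrix \<open>q \<bullet> l p\<close> of pairings between the vertices of \<open>\<Delta>\<close> and those of the dual
  is symmetric: it is \<open>-1\<close> away from the diagonal. This symmetry is selfduality.

  In detail, each \<open>x\<close> has the expansion \<open>x = \<Sum> w p * (x \<bullet> l p) *\<^sub>R p\<close>, and each \<open>y\<close> the
  expansion \<open>y = \<Sum> w p * (p \<bullet> y) *\<^sub>R l p\<close>. The self-adjoint map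
  \<open>\<phi> x = \<Sum> w p * (x \<bullet> l p) *\<^sub>R l p\<close> therefore sends each \<open>p\<close> to \<open>l p\<close>, so it maps \<open>\<Delta>\<close> onto the
  dual simplex; and since \<open>m \<bullet> l p = m \<bullet> \<phi> p = \<phi> m \<bullet> p\<close>, the integrality conditions that
  define the maximal lattice of \<open>\<Delta>\<close> become exactly those that define the maximal lattice of
  the dual.

  The maximal pair of \<open>\<Delta>\<close> must also be shown to be reflexive. The weights
  \<open>w p = 1 / (1 + p \<bullet> l p)\<close> are rational, so by the first expansion some positive multiple of
  \<open>maximal_lattice \<Delta> M\<close> lies in \<open>M\<close>; and a subgroup of a lattice has a basis, by the usual
  elimination of one coordinate after the other. The facet normals stay primitive because the
  dual lattice only shrinks. Reflexivity of the dual pair needs no separate argument: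
  it is transported along \<open>\<phi>\<close>.
\<close>

section \<open>Subgroups of lattices\<close>

definition int_span :: "'a::real_vector set \<Rightarrow> 'a set" where
  "int_span B = {\<Sum>b\<in>B. real_of_int (c b) *\<^sub>R b | c. True}"

text \<open>The single closure condition, with an arbitrary integer factor, makes this the notion of
  an additive subgroup in the form in which the elimination argument uses it.\<close>

definition int_submodule :: "'a::real_vector set \<Rightarrow> bool" where
  "int_submodule L \<longleftrightarrow> 0 \<in> L \<and> (\<forall>x\<in>L. \<forall>y\<in>L. \<forall>k. x + real_of_int k *\<^sub>R y \<in> L)"

lemma int_submoduleD:
  assumes "int_submodule L"
  shows "0 \<in> L" "\<lbrakk>x \<in> L; y \<in> L\<rbrakk> \<Longrightarrow> x + real_of_int k *\<^sub>R y \<in> L"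
    "y \<in> L \<Longrightarrow> real_of_int k *\<^sub>R y \<in> L"
proof -
  show 0: "0 \<in> L" and *: "\<lbrakk>x \<in> L; y \<in> L\<rbrakk> \<Longrightarrow> x + real_of_int k *\<^sub>R y \<in> L" for x y k
    using assms by (auto simp: int_submodule_def)
  show "y \<in> L \<Longrightarrow> real_of_int k *\<^sub>R y \<in> L"
    using *[OF 0, of y k] by simp
qed

lemma int_submodule_sum:
  assumes "int_submodule L" "\<And>i. i \<in> I \<Longrightarrow> f i \<in> L"
  shows "(\<Sum>i\<in>I. real_of_int (c i) *\<^sub>R f i) \<in> L"
  using assms(2)
proof (induction I rule: infinite_finite_induct)
  case (insert i I)
  then show ?case
    using int_submoduleD(2)[OF assms(1), of "\<Sum>i\<in>I. real_of_int (c i) *\<^sub>R f i" "f i" "c i"]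
    by (simp add: add.commute)
qed (simp_all add: int_submoduleD(1)[OF assms(1)])

lemma int_submodule_int_span: "int_submodule (int_span B)"
  unfolding int_submodule_def
proof (intro conjI ballI allI)
  show "0 \<in> int_span B"
    unfolding int_span_def by (auto intro: exI[of _ "\<lambda>_. 0"])
next
  fix x y k assume "x \<in> int_span B" "y \<in> int_span B"
  then obtain c d where "x = (\<Sum>b\<in>B. real_of_int (c b) *\<^sub>R b)"
      "y = (\<Sum>b\<in>B. real_of_int (d b) *\<^sub>R b)"
    unfolding int_span_def by auto
  then have "x + real_of_int k *\<^sub>R y = (\<Sum>b\<in>B. real_of_int (c b + k * d b) *\<^sub>R b)"
    by (simp add: scaleR_sum_right sum.distrib algebra_simps)
  then show "x + real_of_int k *\<^sub>R y \<in> int_span B"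
    unfolding int_span_def by (auto intro: exI[of _ "\<lambda>b. c b + k * d b"])
qed

lemma int_span_subset_span: "int_span B \<subseteq> span B"
  unfolding int_span_def by (auto intro: span_sum span_scale span_base)

lemma int_span_superset: "finite B \<Longrightarrow> B \<subseteq> int_span B"
proof
  fix b assume "finite B" "b \<in> B"
  then have "b = (\<Sum>x\<in>B. real_of_int (if x = b then 1 else 0) *\<^sub>R x)"
    by (simp add: if_distrib[of real_of_int] if_distrib[of "\<lambda>r. r *\<^sub>R _"] cong: if_cong)
  then show "b \<in> int_span B"
    unfolding int_span_def by (intro CollectI exI[of _ "\<lambda>x. if x = b then 1 else 0"]) simp
qed

lemma int_span_insert:
  assumes "finite B" "b \<notin> B"
  shows "int_span (insert b B) = {real_of_int d *\<^sub>R b + u | d u. u \<in> int_span B}"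
proof (intro equalityI subsetI)
  fix x assume "x \<in> int_span (insert b B)"
  then show "x \<in> {real_of_int d *\<^sub>R b + u | d u. u \<in> int_span B}"
    using assms unfolding int_span_def by auto
next
  fix x assume "x \<in> {real_of_int d *\<^sub>R b + u | d u. u \<in> int_span B}"
  then obtain d c where x: "x = real_of_int d *\<^sub>R b + (\<Sum>b\<in>B. real_of_int (c b) *\<^sub>R b)"
    unfolding int_span_def by auto
  have "(\<Sum>a\<in>B. real_of_int ((c(b := d)) a) *\<^sub>R a) = (\<Sum>a\<in>B. real_of_int (c a) *\<^sub>R a)"
    using assms by (intro sum.cong) auto
  then have "x = (\<Sum>a\<in>insert b B. real_of_int ((c(b := d)) a) *\<^sub>R a)"
    using assms x by simp
  then show "x \<in> int_span (insert b B)"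
    unfolding int_span_def by blast
qed

text \<open>Elimination of one coordinate. The coefficients at \<open>b\<close> of the elements of \<open>L\<close> form a
  subgroup of the integers. If it is not zero, an element \<open>v\<close> with the least positive
  coefficient, together with a basis of the elements with coefficient \<open>0\<close>, is a basis of \<open>L\<close>.
  The basis found lies in the span of \<open>B\<close>, which is what keeps \<open>v\<close> independent of the rest.\<close>

lemma int_submodule_has_basis:
  assumes "finite B" "independent B" "int_submodule L" "L \<subseteq> int_span B"
  shows "\<exists>C. finite C \<and> independent C \<and> C \<subseteq> span B \<and> L = int_span C"
  using assms
proof (induction B arbitrary: L rule: finite_induct)
  case empty
  then have "L = int_span {}"
    using int_submoduleD(1)[of L] by (auto simp: int_span_def)
  then show ?case
    using independent_empty by (intro exI[of _ "{}"]) auto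
next
  case (insert b B)
  have b: "b \<notin> span B" and indB: "independent B"
    using insert.prems(1) insert.hyps(2) by (auto simp: independent_insert)
  have "int_submodule (L \<inter> int_span B)"
    using insert.prems(2) int_submodule_int_span[of B] by (auto simp: int_submodule_def)
  from insert.IH[OF indB this] obtain C where C: "finite C" "independent C" "C \<subseteq> span B"
      "L \<inter> int_span B = int_span C"
    by auto
  have coeff: "\<exists>d u. u \<in> int_span B \<and> x = real_of_int d *\<^sub>R b + u" if "x \<in> L" for x
    using that insert.prems(3) unfolding int_span_insert[OF insert.hyps(1,2)] by blast
  define P where
    "P n \<longleftrightarrow> n > 0 \<and> (\<exists>u\<in>int_span B. real n *\<^sub>R b + u \<in> L)" for n :: nat
  show ?case
  proof (cases "\<exists>n. P n")
    case False
    have "L \<subseteq> int_span B"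
    proof
      fix x assume x: "x \<in> L"
      obtain d u where u: "u \<in> int_span B" "x = real_of_int d *\<^sub>R b + u"
        using coeff[OF x] by auto
      have "P (nat \<bar>d\<bar>)" if "d \<noteq> 0"
      proof -
        have "real_of_int (sgn d) *\<^sub>R x = real (nat \<bar>d\<bar>) *\<^sub>R b + real_of_int (sgn d) *\<^sub>R u"
          by (simp add: u(2) scaleR_add_right sgn_if)
        moreover have "real_of_int (sgn d) *\<^sub>R x \<in> L"
          using x by (rule int_submoduleD(3)[OF insert.prems(2)])
        ultimately show ?thesis
          unfolding P_def using that int_submoduleD(3)[OF int_submodule_int_span u(1)] by force
      qed
      then show "x \<in> int_span B"
        using False u by (cases "d = 0") auto
    qed
    then show ?thesis
      using C span_mono[of B "insert b B"] by (intro exI[of _ C]) blast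
  next
    case True
    define n where "n = (LEAST n. P n)"
    have "P n" and least: "P m \<Longrightarrow> n \<le> m" for m
      unfolding n_def using True by (auto intro: LeastI_ex Least_le)
    then obtain u where n: "n > 0" and u: "u \<in> int_span B" "real n *\<^sub>R b + u \<in> L"
      by (auto simp: P_def)
    define v where "v = real n *\<^sub>R b + u"
    have v: "v \<notin> span C"
    proof
      assume "v \<in> span C"
      then have "v \<in> span B"
        using C(3) by (meson span_minimal subsetD subspace_span)
      then have "v - u \<in> span B"
        using u(1) int_span_subset_span by (blast intro: span_diff)
      then have "real n *\<^sub>R b \<in> span B"
        by (simp add: v_def)
      then have "(1 / real n) *\<^sub>R (real n *\<^sub>R b) \<in> span B"
        by (rule span_scale)
      then show False
        using n b by simp
    qed
    then have vC: "v \<notin> C"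
      using span_base by blast
    have "L = int_span (insert v C)"
    proof (intro equalityI subsetI)
      fix x assume x: "x \<in> L"
      obtain d t where t: "t \<in> int_span B" "x = real_of_int d *\<^sub>R b + t"
        using coeff[OF x] by auto
      define q r where "q = d div int n" and "r = d mod int n"
      have d: "d = int n * q + r" and r: "0 \<le> r" "r < int n"
        using n by (auto simp: q_def r_def)
      define t' where "t' = t + real_of_int (- q) *\<^sub>R u"
      have t': "t' \<in> int_span B"
        unfolding t'_def by (rule int_submoduleD(2)[OF int_submodule_int_span t(1) u(1)])
      have xq: "x + real_of_int (- q) *\<^sub>R v = real (nat r) *\<^sub>R b + t'"
        using r(1) by (simp add: t(2) t'_def v_def d algebra_simps)
      have L: "x + real_of_int (- q) *\<^sub>R v \<in> L"
        using x u(2) by (auto simp only: v_def intro!: int_submoduleD(2)[OF insert.prems(2)])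
      \<comment> \<open>The remainder of the coefficient is smaller than the least positive one, hence zero.\<close>
      have "\<not> P (nat r)"
        using least[of "nat r"] r by auto
      then have "nat r = 0"
        using L t' unfolding xq P_def by (meson neq0_conv)
      then have "x + real_of_int (- q) *\<^sub>R v \<in> int_span C"
        using L t' xq C(4) by auto
      then show "x \<in> int_span (insert v C)"
        unfolding int_span_insert[OF C(1) vC]
        by (auto intro!: exI[of _ q] exI[of _ "x - real_of_int q *\<^sub>R v"])
    next
      fix x assume "x \<in> int_span (insert v C)"
      then obtain d t where "x = t + real_of_int d *\<^sub>R v" "t \<in> int_span C"
        unfolding int_span_insert[OF C(1) vC] by (auto simp: add.commute)
      then show "x \<in> L"
        using C(4) u(2) int_submoduleD(2)[OF insert.prems(2), of t v] by (auto simp: v_def)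
    qed
    moreover have "independent (insert v C)"
      using v C(2) by (simp add: independent_insertI)
    moreover have "insert v C \<subseteq> span (insert b B)"
    proof -
      have "u \<in> span (insert b B)"
        using u(1) int_span_subset_span span_mono[of B "insert b B"] by blast
      then have "v \<in> span (insert b B)"
        unfolding v_def by (intro span_add[OF span_scale[OF span_base]]) auto
      then show ?thesis
        using C(3) span_mono[of B "insert b B"] by auto
    qed
    ultimately show ?thesis
      using C(1) by (intro exI[of _ "insert v C"]) auto
  qed
qed

section \<open>Full lattices and their images\<close>

lemma full_lattice_iff:
  "full_lattice M \<longleftrightarrow> (\<exists>B. independent B \<and> span B = UNIV \<and> M = int_span B)"
  unfolding full_lattice_def int_span_def ..

lemma int_submodule_full_lattice: "full_lattice M \<Longrightarrow> int_submodule M"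
  by (auto simp: full_lattice_iff int_submodule_int_span)

lemma int_submodule_dual_lattice: "int_submodule (dual_lattice M)"
  by (auto simp: int_submodule_def dual_lattice_def inner_add_right)

lemma full_lattice_linear_image:
  fixes f :: "'a::euclidean_space \<Rightarrow> 'a"
  assumes "linear f" "inj f" "full_lattice M"
  shows "full_lattice (f ` M)"
proof -
  obtain B where B: "independent B" "span B = UNIV" "M = int_span B"
    using assms(3) by (auto simp: full_lattice_iff)
  have "independent (f ` B)"
    using linear_independent_injective_image[OF assms(1) B(1)] assms(2)
    by (meson inj_on_subset subset_UNIV)
  moreover have "span (f ` B) = UNIV"
    using B(2) linear_injective_imp_surjective[OF assms(1,2)]
    by (simp add: linear_span_image[OF assms(1)])
  moreover have "f ` M = int_span (f ` B)"
  proof (intro equalityI subsetI)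
    fix y assume "y \<in> f ` M"
    then obtain c where "y = f (\<Sum>b\<in>B. real_of_int (c b) *\<^sub>R b)"
      by (auto simp: B(3) int_span_def)
    also have "\<dots> = (\<Sum>b\<in>B. real_of_int (c b) *\<^sub>R f b)"
      by (simp add: linear_sum[OF assms(1)] linear_cmul[OF assms(1)])
    also have "\<dots> \<in> int_span (f ` B)"
      using int_span_superset[of "f ` B"] independent_imp_finite[OF B(1)]
      by (intro int_submodule_sum int_submodule_int_span) auto
    finally show "y \<in> int_span (f ` B)" .
  next
    fix y assume "y \<in> int_span (f ` B)"
    then obtain c where "y = (\<Sum>b\<in>f ` B. real_of_int (c b) *\<^sub>R b)"
      by (auto simp: int_span_def)
    also have "\<dots> = (\<Sum>b\<in>B. real_of_int (c (f b)) *\<^sub>R f b)"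
      by (subst sum.reindex) (use assms(2) in \<open>auto intro: inj_on_subset\<close>)
    also have "\<dots> = f (\<Sum>b\<in>B. real_of_int (c (f b)) *\<^sub>R b)"
      by (simp add: linear_sum[OF assms(1)] linear_cmul[OF assms(1)])
    also have "\<dots> \<in> f ` M"
      unfolding B(3) int_span_def by (intro imageI CollectI exI[of _ "\<lambda>b. c (f b)"]) simp
    finally show "y \<in> f ` M" .
  qed
  ultimately show ?thesis
    unfolding full_lattice_iff by blast
qed

lemma full_lattice_scale:
  fixes M :: "'a::euclidean_space set"
  assumes "full_lattice M" "r \<noteq> 0"
  shows "full_lattice ((\<lambda>x. r *\<^sub>R x) ` M)"
  using assms by (intro full_lattice_linear_image) (auto simp: inj_on_def)

text \<open>The group \<open>k L\<close> lies in \<open>M\<close>, so it has a basis, and it contains \<open>k M\<close>, so this basis spans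
  the space. Division by \<open>k\<close> makes it a basis of \<open>L\<close>.\<close>

lemma full_lattice_commensurable:
  fixes L M :: "'a::euclidean_space set"
  assumes "full_lattice M" "int_submodule L" "M \<subseteq> L"
    and k: "k > 0" "\<And>x. x \<in> L \<Longrightarrow> real k *\<^sub>R x \<in> M"
  shows "full_lattice L"
proof -
  obtain B where B: "independent B" "span B = UNIV" "M = int_span B"
    using assms(1) by (auto simp: full_lattice_iff)
  have finB: "finite B"
    using B(1) by (rule independent_imp_finite)
  define kL where "kL = (\<lambda>x. real k *\<^sub>R x) ` L"
  have "int_submodule kL"
    unfolding int_submodule_def
  proof (intro conjI ballI allI)
    show "0 \<in> kL"
      unfolding kL_def using int_submoduleD(1)[OF assms(2)] by force
    fix x y j assume "x \<in> kL" "y \<in> kL"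
    then obtain x' y' where "x' \<in> L" "y' \<in> L" "x = real k *\<^sub>R x'" "y = real k *\<^sub>R y'"
      by (auto simp: kL_def)
    then show "x + real_of_int j *\<^sub>R y \<in> kL"
      unfolding kL_def using int_submoduleD(2)[OF assms(2), of x' y' j]
      by (intro image_eqI[of _ _ "x' + real_of_int j *\<^sub>R y'"]) (auto simp: algebra_simps)
  qed
  then obtain C where C: "finite C" "independent C" "kL = int_span C"
    using int_submodule_has_basis[OF finB B(1), of kL] k(2) B(3) by (auto simp: kL_def)
  have "B \<subseteq> span C"
  proof
    fix b assume "b \<in> B"
    then have "real k *\<^sub>R b \<in> kL"
      using int_span_superset[OF finB] B(3) assms(3) by (auto simp: kL_def)
    then have "(1 / real k) *\<^sub>R (real k *\<^sub>R b) \<in> span C"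
      using C(3) int_span_subset_span by (blast intro: span_scale)
    then show "b \<in> span C"
      using k(1) by simp
  qed
  then have "span C = UNIV"
    using B(2) span_minimal[of B "span C"] subspace_span by auto
  then have "full_lattice kL"
    using C by (auto simp: full_lattice_iff)
  then have "full_lattice ((\<lambda>x. (1 / real k) *\<^sub>R x) ` kL)"
    using k(1) by (intro full_lattice_scale) auto
  moreover have "(\<lambda>x. (1 / real k) *\<^sub>R x) ` kL = L"
    using k(1) by (simp add: kL_def image_image)
  ultimately show ?thesis
    by simp
qed

text \<open>Passing to a smaller lattice can only remove divisors.\<close>

lemma primitive_in_subset:
  assumes "primitive_in L v" "L' \<subseteq> L" "v \<in> L'"
  shows "primitive_in L' v"
  using assms unfolding primitive_in_def by blast

lemma primitive_in_minus:
  assumes "primitive_in L v" "int_submodule L"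
  shows "primitive_in L (- v)"
  unfolding primitive_in_def
proof (intro conjI ballI allI impI)
  show "- v \<in> L" "- v \<noteq> 0"
    using assms int_submoduleD(3)[OF assms(2), of v "-1"] by (auto simp: primitive_in_def)
next
  fix u k assume "u \<in> L" "- v = real_of_int k *\<^sub>R u"
  then have "u \<in> L" "v = real_of_int (- k) *\<^sub>R u"
    by (auto simp: minus_equation_iff[of v])
  then have "\<bar>- k\<bar> = 1"
    using assms(1) unfolding primitive_in_def by blast
  then show "\<bar>k\<bar> = 1"
    by simp
qed

text \<open>Every ingredient of reflexivity is transported by a linear isomorphism \<open>f\<close>; facet normals
  are transported by the inverse of the adjoint of \<open>f\<close>, which identifies the dual lattices.\<close>

lemma reflexive_pair_linear_image:
  fixes f :: "'a::euclidean_space \<Rightarrow> 'a"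
  assumes f: "linear f" "inj f" and refl: "reflexive_pair \<Delta> M"
  shows "reflexive_pair (f ` \<Delta>) (f ` M)"
proof -
  have "surj f"
    using linear_injective_imp_surjective[OF f] by simp
  define g where "g = adjoint f"
  have g: "linear g" and adj: "f x \<bullet> y = x \<bullet> g y" for x y
    unfolding g_def using adjoint_linear[OF f(1)] adjoint_works[OF f(1)] by auto
  have inj_g: "inj g"
  proof (rule injI)
    fix x y assume "g x = g y"
    then have "f z \<bullet> x = f z \<bullet> y" for z
      by (simp add: adj)
    then show "x = y"
      using \<open>surj f\<close> by (metis surjD vector_eq_ldot)
  qed
  have surj_g: "surj g"
    using linear_injective_imp_surjective[OF g inj_g] by simp
  have dual: "y \<in> dual_lattice (f ` M) \<longleftrightarrow> g y \<in> dual_lattice M" for y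
    by (auto simp: dual_lattice_def adj)
  have prim: "primitive_in (dual_lattice (f ` M)) y" if "primitive_in (dual_lattice M) (g y)" for y
    unfolding primitive_in_def
  proof (intro conjI ballI allI impI)
    show "y \<in> dual_lattice (f ` M)" "y \<noteq> 0"
      using that linear_0[OF g] by (auto simp: primitive_in_def dual)
  next
    fix u k assume "u \<in> dual_lattice (f ` M)" "y = real_of_int k *\<^sub>R u"
    then have "g u \<in> dual_lattice M" "g y = real_of_int k *\<^sub>R g u"
      by (auto simp: dual linear_cmul[OF g])
    then show "\<bar>k\<bar> = 1"
      using that unfolding primitive_in_def by blast
  qed
  have facets: "\<exists>l c. primitive_in (dual_lattice (f ` M)) l \<and> \<bar>c\<bar> = 1 \<and>
      affine hull F = {x. x \<bullet> l = c}" if F: "F facet_of f ` \<Delta>" for F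
  proof -
    have "F face_of f ` \<Delta>"
      using F by (rule facet_of_imp_face_of)
    then obtain G where G: "F = f ` G"
      by (meson face_of_imp_subset subset_imageE)
    then have "G facet_of \<Delta>"
      using F f by (simp add: facet_of_def face_of_linear_image)
    then obtain l' c where l': "primitive_in (dual_lattice M) l'" "\<bar>c\<bar> = 1"
        "affine hull G = {x. x \<bullet> l' = c}"
      using refl unfolding reflexive_pair_def by blast
    obtain l where l: "l' = g l"
      using surj_g by blast
    have "affine hull F = f ` {x. x \<bullet> l' = c}"
      using f(1) by (simp add: G l'(3)[symmetric] affine_hull_linear_image
          linear_conv_bounded_linear)
    also have "\<dots> = {x. x \<bullet> l = c}"
    proof (intro equalityI subsetI)
      fix x assume "x \<in> {x. x \<bullet> l = c}"
      moreover obtain x' where "x = f x'"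
        using \<open>surj f\<close> by blast
      ultimately show "x \<in> f ` {x. x \<bullet> l' = c}"
        by (auto simp: l adj)
    qed (auto simp: l adj)
    finally show ?thesis
      using l'(1,2) prim l by blast
  qed
  have verts: "vertices (f ` \<Delta>) \<subseteq> f ` M"
  proof
    fix x assume x: "x \<in> vertices (f ` \<Delta>)"
    then obtain y where y: "x = f y"
      by (auto simp: vertices_def extreme_point_of_def)
    have "f ` {y} face_of f ` \<Delta>"
      using x y by (simp add: vertices_def face_of_singleton)
    then have "y \<in> vertices \<Delta>"
      using f by (simp only: face_of_linear_image vertices_def mem_Collect_eq face_of_singleton)
    then show "x \<in> f ` M"
      using refl y by (auto simp: reflexive_pair_def)
  qed
  have "0 \<in> interior (f ` \<Delta>)"
    using refl f linear_0[OF f(1)]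
    by (auto simp: reflexive_pair_def interior_injective_linear_image intro: image_eqI[of _ _ 0])
  then show ?thesis
    using refl f facets verts
    by (auto simp: reflexive_pair_def full_lattice_linear_image polytope_linear_image)
qed

section \<open>A simplex and its facet normals\<close>

text \<open>The vertices \<open>C\<close> of a simplex around the origin, the barycentric coordinates \<open>w\<close> of the
  origin, and the facet normals \<open>l\<close>, at first without any lattice.\<close>

locale centred_simplex =
  fixes C :: "'a::euclidean_space set" and l :: "'a \<Rightarrow> 'a" and w :: "'a \<Rightarrow> real"
  assumes finite_C: "finite C" and span_C: "span C = UNIV"
    and w_pos: "p \<in> C \<Longrightarrow> w p > 0" and w_sum: "sum w C = 1"
    and w_centre: "(\<Sum>p\<in>C. w p *\<^sub>R p) = 0"
    and off_diagonal: "\<lbrakk>p \<in> C; q \<in> C; q \<noteq> p\<rbrakk> \<Longrightarrow> q \<bullet> l p = -1"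
begin

text \<open>The relation \<open>\<Sum> w q *\<^sub>R q = 0\<close>, paired with \<open>l p\<close>, determines the diagonal.\<close>

lemma diagonal:
  assumes "p \<in> C"
  shows "w p * (p \<bullet> l p + 1) = 1"
proof -
  have "(\<Sum>q\<in>C. w q * (q \<bullet> l p + 1)) = (\<Sum>q\<in>C. w q *\<^sub>R q) \<bullet> l p + sum w C"
    by (simp add: inner_sum_left sum.distrib algebra_simps)
  also have "\<dots> = 1"
    by (simp add: w_centre w_sum)
  finally have "(\<Sum>q\<in>C. w q * (q \<bullet> l p + 1)) = 1" .
  moreover have "(\<Sum>q\<in>C. w q * (q \<bullet> l p + 1)) = (\<Sum>q\<in>{p}. w q * (q \<bullet> l p + 1))"
    using assms finite_C off_diagonal[OF assms] by (intro sum.mono_neutral_right) auto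
  ultimately show ?thesis
    by simp
qed

lemma pairing_symmetric: "\<lbrakk>p \<in> C; q \<in> C\<rbrakk> \<Longrightarrow> q \<bullet> l p = p \<bullet> l q"
  using off_diagonal by metis

lemma linear_eq_on_vertices:
  assumes "linear f" "linear g" "\<And>p. p \<in> C \<Longrightarrow> f p = g p"
  shows "f x = g x"
  using linear_eq_on[OF assms(1,2), of x C] assms(3) span_C by auto

lemma expansion: "(\<Sum>p\<in>C. (w p * (x \<bullet> l p)) *\<^sub>R p) = x"
proof (rule linear_eq_on_vertices[of "\<lambda>x. \<Sum>p\<in>C. (w p * (x \<bullet> l p)) *\<^sub>R p" "\<lambda>x. x"])
  show "linear (\<lambda>x. \<Sum>p\<in>C. (w p * (x \<bullet> l p)) *\<^sub>R p)" "linear (\<lambda>x::'a. x)"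
    by (auto intro!: linearI simp: sum.distrib scaleR_sum_right algebra_simps)
  fix q assume q: "q \<in> C"
  have "(\<Sum>p\<in>C. (w p * (q \<bullet> l p)) *\<^sub>R p) =
      (\<Sum>p\<in>C. (w p * (q \<bullet> l p + 1)) *\<^sub>R p) - (\<Sum>p\<in>C. w p *\<^sub>R p)"
    by (simp add: algebra_simps sum.distrib)
  also have "(\<Sum>p\<in>C. (w p * (q \<bullet> l p + 1)) *\<^sub>R p) = (\<Sum>p\<in>{q}. (w p * (q \<bullet> l p + 1)) *\<^sub>R p)"
    using q finite_C off_diagonal[of _ q] by (intro sum.mono_neutral_right) auto
  also have "\<dots> = q"
    using diagonal[OF q] by simp
  finally show "(\<Sum>p\<in>C. (w p * (q \<bullet> l p)) *\<^sub>R p) = q"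
    by (simp add: w_centre)
qed

text \<open>This is the previous expansion read off after pairing with an arbitrary \<open>x\<close>.\<close>

lemma dual_expansion: "(\<Sum>p\<in>C. (w p * (p \<bullet> y)) *\<^sub>R l p) = y"
proof (rule vector_eq_rdot[THEN iffD1], intro allI)
  fix x
  have "x \<bullet> y = (\<Sum>p\<in>C. (w p * (x \<bullet> l p)) *\<^sub>R p) \<bullet> y"
    by (simp add: expansion)
  also have "\<dots> = x \<bullet> (\<Sum>p\<in>C. (w p * (p \<bullet> y)) *\<^sub>R l p)"
    by (simp add: inner_sum_left inner_sum_right algebra_simps)
  finally show "(\<Sum>p\<in>C. (w p * (p \<bullet> y)) *\<^sub>R l p) \<bullet> x = y \<bullet> x"
    by (simp add: inner_commute)
qed

definition duality :: "'a \<Rightarrow> 'a" where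
  "duality x = (\<Sum>p\<in>C. (w p * (x \<bullet> l p)) *\<^sub>R l p)"

lemma linear_duality: "linear duality"
  unfolding duality_def
  by (auto intro!: linearI simp: sum.distrib scaleR_sum_right algebra_simps)

lemma duality_self_adjoint: "duality x \<bullet> y = x \<bullet> duality y"
  by (simp add: duality_def inner_sum_left inner_sum_right algebra_simps inner_commute)

text \<open>By the symmetry of the pairing the coefficients of \<open>duality p\<close> are those in the dual
  expansion of \<open>l p\<close>.\<close>

lemma duality_vertex:
  assumes "p \<in> C"
  shows "duality p = l p"
proof -
  have "duality p = (\<Sum>q\<in>C. (w q * (q \<bullet> l p)) *\<^sub>R l q)"
    unfolding duality_def using assms by (intro sum.cong) (auto simp: pairing_symmetric)
  then show ?thesis
    by (simp add: dual_expansion)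
qed

lemma surj_duality: "surj duality"
proof (rule surjI)
  fix y
  have "duality (\<Sum>p\<in>C. (w p * (p \<bullet> y)) *\<^sub>R p) = (\<Sum>p\<in>C. (w p * (p \<bullet> y)) *\<^sub>R l p)"
    by (simp add: linear_sum[OF linear_duality] linear_cmul[OF linear_duality] duality_vertex
        cong: sum.cong)
  then show "duality (\<Sum>p\<in>C. (w p * (p \<bullet> y)) *\<^sub>R p) = y"
    by (simp add: dual_expansion)
qed

lemma inj_duality: "inj duality"
  using linear_surjective_imp_injective[OF linear_duality surj_duality] by simp

lemma dual_polytope_eq: "dual_polytope (convex hull C) = duality ` (convex hull C)"
proof -
  have "duality ` (convex hull C) = convex hull (l ` C)"
    using convex_hull_linear_image[OF linear_duality, of C] duality_vertex by simp
  also have "\<dots> = dual_polytope (convex hull C)"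
  proof (intro equalityI subsetI)
    fix y assume y: "y \<in> convex hull (l ` C)"
    have "C \<subseteq> {x. -1 \<le> l p \<bullet> x}" if p: "p \<in> C" for p
    proof
      fix q assume q: "q \<in> C"
      have "q \<bullet> l q + 1 > 0"
        using diagonal[OF q] w_pos[OF q] by (metis zero_less_mult_pos zero_less_one)
      then show "q \<in> {x. -1 \<le> l p \<bullet> x}"
        using off_diagonal[OF p q] by (cases "q = p") (auto simp: inner_commute)
    qed
    then have vertex: "-1 \<le> x \<bullet> l p" if "x \<in> convex hull C" "p \<in> C" for x p
      using that hull_minimal[of C "{x. -1 \<le> l p \<bullet> x}" convex] convex_halfspace_ge[of "-1" "l p"]
      by (auto simp: inner_commute)
    have "-1 \<le> x \<bullet> y" if "x \<in> convex hull C" for x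
    proof -
      have "l ` C \<subseteq> {y. x \<bullet> y \<ge> -1}"
        using vertex[OF that] by auto
      then have "convex hull (l ` C) \<subseteq> {y. x \<bullet> y \<ge> -1}"
        by (rule hull_minimal) (rule convex_halfspace_ge)
      then show ?thesis
        using y by auto
    qed
    then show "y \<in> dual_polytope (convex hull C)"
      by (simp add: dual_polytope_def)
  next
    fix y assume y: "y \<in> dual_polytope (convex hull C)"
    \<comment> \<open>Since \<open>\<Sum> w p *\<^sub>R l p = 0\<close>, the coefficients in the dual expansion of \<open>y\<close> may be shifted
      by \<open>w p\<close>, which makes them nonnegative with sum \<open>1\<close>.\<close>
    have "(\<Sum>p\<in>C. w p *\<^sub>R l p) = duality (\<Sum>p\<in>C. w p *\<^sub>R p)"
      by (simp add: linear_sum[OF linear_duality] linear_cmul[OF linear_duality] duality_vertex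
          cong: sum.cong)
    then have centre: "(\<Sum>p\<in>C. w p *\<^sub>R l p) = 0"
      by (simp add: w_centre linear_0[OF linear_duality])
    have "y = (\<Sum>p\<in>C. (w p * (p \<bullet> y + 1)) *\<^sub>R l p)"
      by (simp add: distrib_left scaleR_left_distrib sum.distrib dual_expansion centre)
    also have "\<dots> \<in> convex hull (l ` C)"
    proof (rule convex_sum[OF finite_C convex_convex_hull])
      have "(\<Sum>p\<in>C. w p * (p \<bullet> y + 1)) = (\<Sum>p\<in>C. w p *\<^sub>R p) \<bullet> y + sum w C"
        by (simp add: inner_sum_left sum.distrib algebra_simps)
      then show "(\<Sum>p\<in>C. w p * (p \<bullet> y + 1)) = 1"
        by (simp add: w_centre w_sum)
      show "0 \<le> w p * (p \<bullet> y + 1)" if "p \<in> C" for p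
      proof -
        have "-1 \<le> p \<bullet> y"
          using y that hull_inc[of p C convex] by (auto simp: dual_polytope_def)
        then show ?thesis
          using w_pos[OF that] by (intro mult_nonneg_nonneg) auto
      qed
      show "l p \<in> convex hull (l ` C)" if "p \<in> C" for p
        using that by (simp add: hull_inc)
    qed
    finally show "y \<in> convex hull (l ` C)" .
  qed
  finally show ?thesis ..
qed

end

section \<open>The lattices of a reflexive simplex\<close>

lemma rational_common_denominator:
  fixes w :: "'b \<Rightarrow> real"
  assumes "finite C" "\<And>p. p \<in> C \<Longrightarrow> w p \<in> \<rat>"
  shows "\<exists>k::nat. k > 0 \<and> (\<forall>p\<in>C. real k * w p \<in> \<int>)"
  using assms
proof (induction C rule: finite_induct)
  case (insert p C)
  then obtain k :: nat where k: "k > 0" "\<forall>q\<in>C. real k * w q \<in> \<int>"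
    by auto
  obtain a b :: int where ab: "b > 0" "w p = real_of_int a / real_of_int b"
    using insert.prems[of p] by (auto elim: Rats_cases')
  have "real (k * nat b) * w p = real_of_int (int k * a)"
    using ab by simp
  then have "real (k * nat b) * w p \<in> \<int>"
    by (metis Ints_of_int)
  moreover have "real (k * nat b) * w q \<in> \<int>" if "q \<in> C" for q
  proof -
    have "real (k * nat b) * w q = real (nat b) * (real k * w q)"
      by simp
    also have "\<dots> \<in> \<int>"
      using k(2) that Ints_mult[OF Ints_of_nat[of "nat b"], of "real k * w q"] by blast
    finally show ?thesis .
  qed
  ultimately show ?case
    using k(1) ab(1) by (intro exI[of _ "k * nat b"]) auto
qed (auto intro: exI[of _ 1])

locale reflexive_simplex_data = centred_simplex C l w
  for C :: "'a::euclidean_space set" and l :: "'a \<Rightarrow> 'a" and w :: "'a \<Rightarrow> real" +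
  fixes M :: "'a set"
  assumes affine_independent: "\<not> affine_dependent C"
    and reflexive: "reflexive_pair (convex hull C) M"
    and primitive_normal: "p \<in> C \<Longrightarrow> primitive_in (dual_lattice M) (l p)"
    and facet_hyperplane:
      "p \<in> C \<Longrightarrow> C - {p} \<noteq> {} \<Longrightarrow> affine hull (convex hull (C - {p})) = {x. x \<bullet> l p = -1}"
begin

lemma vertices_simplex: "vertices (convex hull C) = C"
  using affine_independent
  by (auto simp: vertices_def extreme_point_of_convex_hull_affine_independent)

lemma vertices_dual: "vertices (dual_polytope (convex hull C)) = l ` C"
proof -
  have "y extreme_point_of duality ` (convex hull C) \<longleftrightarrow> y \<in> duality ` C" for y
  proof -
    obtain x where y: "y = duality x"
      using surj_duality by blast
    have "y extreme_point_of duality ` (convex hull C) \<longleftrightarrow>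
        duality ` {x} face_of duality ` (convex hull C)"
      by (simp add: y face_of_singleton)
    also have "\<dots> \<longleftrightarrow> x extreme_point_of (convex hull C)"
      by (simp only: face_of_linear_image[OF linear_duality inj_duality] face_of_singleton)
    also have "\<dots> \<longleftrightarrow> y \<in> duality ` C"
      using vertices_simplex by (auto simp: y vertices_def inj_image_mem_iff[OF inj_duality])
    finally show ?thesis .
  qed
  then show ?thesis
    using duality_vertex by (auto simp: dual_polytope_eq vertices_def image_iff)
qed

lemma lattice_M: "full_lattice M" and vertex_in_M: "C \<subseteq> M"
  using reflexive vertices_simplex by (auto simp: reflexive_pair_def)

lemma normal_in_dual: "p \<in> C \<Longrightarrow> l p \<in> dual_lattice M"
  using primitive_normal by (auto simp: primitive_in_def)

lemma pairing_integer: "\<lbrakk>m \<in> M; p \<in> C\<rbrakk> \<Longrightarrow> m \<bullet> l p \<in> \<int>"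
  using normal_in_dual by (auto simp: dual_lattice_def)

lemma common_denominator:
  obtains k :: nat where "k > 0" "\<And>p. p \<in> C \<Longrightarrow> real k * w p \<in> \<int>"
proof -
  have "w p \<in> \<rat>" if p: "p \<in> C" for p
  proof -
    have "w p = 1 / (p \<bullet> l p + 1)"
      using diagonal[OF p] by (metis mult_zero_right nonzero_eq_divide_eq zero_neq_one)
    moreover have "p \<bullet> l p \<in> \<rat>"
      using pairing_integer[of p p] p vertex_in_M Ints_subset_Rats by blast
    ultimately show ?thesis
      by simp
  qed
  then show ?thesis
    using rational_common_denominator[OF finite_C, of w] that by blast
qed

lemma scaled_combination_in_submodule:
  assumes "int_submodule L" "\<And>p. p \<in> C \<Longrightarrow> real k * w p \<in> \<int>"
    "\<And>p. p \<in> C \<Longrightarrow> a p \<in> \<int>" "\<And>p. p \<in> C \<Longrightarrow> f p \<in> L"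
  shows "real k *\<^sub>R (\<Sum>p\<in>C. (w p * a p) *\<^sub>R f p) \<in> L"
proof -
  have "real k *\<^sub>R (\<Sum>p\<in>C. (w p * a p) *\<^sub>R f p) =
      (\<Sum>p\<in>C. real_of_int \<lfloor>(real k * w p) * a p\<rfloor> *\<^sub>R f p)"
    unfolding scaleR_sum_right
  proof (intro sum.cong refl)
    fix p assume "p \<in> C"
    then have "(real k * w p) * a p \<in> \<int>"
      using assms(2,3) by (intro Ints_mult[of "real k * w p"])
    then show "real k *\<^sub>R (w p * a p) *\<^sub>R f p = real_of_int \<lfloor>(real k * w p) * a p\<rfloor> *\<^sub>R f p"
      by (auto elim!: Ints_cases simp: mult.assoc)
  qed
  also have "\<dots> \<in> L"
    using assms(1,4) by (rule int_submodule_sum)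
  finally show ?thesis .
qed

lemma multiple_in_lattice:
  assumes "\<And>p. p \<in> C \<Longrightarrow> real k * w p \<in> \<int>" "\<And>p. p \<in> C \<Longrightarrow> m \<bullet> l p \<in> \<int>"
  shows "real k *\<^sub>R m \<in> M"
  using scaled_combination_in_submodule[OF int_submodule_full_lattice[OF lattice_M], of k
      "\<lambda>p. m \<bullet> l p" "\<lambda>p. p"] assms vertex_in_M by (auto simp: expansion)

lemma multiple_in_dual_lattice:
  assumes "\<And>p. p \<in> C \<Longrightarrow> real k * w p \<in> \<int>" "\<And>p. p \<in> C \<Longrightarrow> p \<bullet> y \<in> \<int>"
  shows "real k *\<^sub>R y \<in> dual_lattice M"
  using scaled_combination_in_submodule[OF int_submodule_dual_lattice, of k
      "\<lambda>p. p \<bullet> y" l] assms normal_in_dual by (auto simp: dual_expansion)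

text \<open>In the two maximal lattices rationality follows from the integrality conditions, because the
  common denominator \<open>k\<close> of the weights clears all denominators in the expansions.\<close>

lemma maximal_lattice_eq: "maximal_lattice (convex hull C) M = {m. \<forall>p\<in>C. m \<bullet> l p \<in> \<int>}"
proof -
  obtain k :: nat where "k > 0" "\<And>p. p \<in> C \<Longrightarrow> real k * w p \<in> \<int>"
    using common_denominator by blast
  then show ?thesis
    using multiple_in_lattice unfolding maximal_lattice_def vertices_dual rational_span_def by auto
qed

lemma maximal_dual_lattice_eq:
  "maximal_dual_lattice (convex hull C) M = {y. \<forall>p\<in>C. p \<bullet> y \<in> \<int>}"
proof -
  obtain k :: nat where "k > 0" "\<And>p. p \<in> C \<Longrightarrow> real k * w p \<in> \<int>"
    using common_denominator by blast
  then show ?thesis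
    using multiple_in_dual_lattice
    unfolding maximal_dual_lattice_def vertices_simplex rational_span_def by auto
qed

lemma duality_maximal_lattice:
  "duality ` maximal_lattice (convex hull C) M = maximal_dual_lattice (convex hull C) M"
proof -
  have "duality x \<in> maximal_dual_lattice (convex hull C) M \<longleftrightarrow>
      x \<in> maximal_lattice (convex hull C) M" for x
    unfolding maximal_dual_lattice_eq maximal_lattice_eq
    using duality_self_adjoint[of x] by (auto simp: duality_vertex inner_commute)
  then show ?thesis
    using surj_duality by (auto simp: image_iff surj_def) metis
qed

lemma maximal_pair_reflexive:
  "reflexive_pair (convex hull C) (maximal_lattice (convex hull C) M)"
proof -
  let ?L = "maximal_lattice (convex hull C) M"
  have M_subset: "M \<subseteq> ?L"
    unfolding maximal_lattice_eq using pairing_integer by auto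
  have "int_submodule ?L"
    unfolding maximal_lattice_eq int_submodule_def by (auto simp: inner_add_left)
  moreover obtain k :: nat where "k > 0" "\<And>p. p \<in> C \<Longrightarrow> real k * w p \<in> \<int>"
    using common_denominator by blast
  ultimately have full: "full_lattice ?L"
    using multiple_in_lattice
    by (intro full_lattice_commensurable[OF lattice_M _ M_subset, of k])
      (auto simp: maximal_lattice_eq)
  have "\<exists>n c. primitive_in (dual_lattice ?L) n \<and> \<bar>c\<bar> = 1 \<and> affine hull F = {x. x \<bullet> n = c}"
    if F: "F facet_of convex hull C" for F
  proof -
    obtain p where p: "p \<in> C" "F = convex hull (C - {p})" "F \<noteq> {}"
      using F unfolding facet_of_convex_hull_affine_independent[OF affine_independent] by blast
    then have "affine hull F = {x. x \<bullet> l p = -1}"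
      using facet_hyperplane[of p] by auto
    moreover have "primitive_in (dual_lattice ?L) (l p)"
    proof (rule primitive_in_subset[OF primitive_normal[OF p(1)]])
      show "dual_lattice ?L \<subseteq> dual_lattice M"
        using M_subset by (auto simp: dual_lattice_def)
      show "l p \<in> dual_lattice ?L"
        using p(1) by (auto simp: dual_lattice_def maximal_lattice_eq)
    qed
    ultimately show ?thesis
      by (intro exI[of _ "l p"] exI[of _ "-1"]) auto
  qed
  then show ?thesis
    using reflexive full M_subset unfolding reflexive_pair_def by blast
qed

lemma selfdual_simplex: "selfdual (convex hull C) M"
proof -
  have "reflexive_pair (duality ` (convex hull C))
      (duality ` maximal_lattice (convex hull C) M)"
    by (rule reflexive_pair_linear_image[OF linear_duality inj_duality maximal_pair_reflexive])
  moreover have "bij_betw duality (maximal_lattice (convex hull C) M)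
      (maximal_dual_lattice (convex hull C) M)"
    using inj_duality duality_maximal_lattice by (auto simp: bij_betw_def intro: inj_on_subset)
  ultimately show ?thesis
    unfolding selfdual_def reflexive_isomorphism_def finite_morphism_def
    using linear_duality maximal_pair_reflexive dual_polytope_eq duality_maximal_lattice
    by (intro exI[of _ duality]) auto
qed

end

text \<open>The sign of a facet normal is fixed by demanding the value \<open>-1\<close> on the facet, so that the
  normals are the vertices of the dual.\<close>

lemma reflexive_facet_normal:
  assumes "reflexive_pair \<Delta> M" "F facet_of \<Delta>"
  obtains n where "primitive_in (dual_lattice M) n" "affine hull F = {x. x \<bullet> n = -1}"
proof -
  have "\<exists>n c. primitive_in (dual_lattice M) n \<and> \<bar>c\<bar> = 1 \<and> affine hull F = {x. x \<bullet> n = c}"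
    using assms by (simp add: reflexive_pair_def)
  then obtain n c where
    n: "primitive_in (dual_lattice M) n" "\<bar>c\<bar> = 1" "affine hull F = {x. x \<bullet> n = c}"
    by (elim exE conjE)
  consider "c = 1" | "c = -1"
    using n(2) by linarith
  then show ?thesis
  proof cases
    case 1
    have "affine hull F = {x. x \<bullet> - n = -1}"
      unfolding n(3) 1 by simp
    then show ?thesis
      by (rule that[OF primitive_in_minus[OF n(1) int_submodule_dual_lattice]])
  next
    case 2
    show ?thesis
      by (rule that[OF n(1) n(3)[unfolded 2]])
  qed
qed

lemma reflexive_simplex_normal_form:
  fixes \<Delta> M :: "'a::euclidean_space set"
  assumes "reflexive_simplex \<Delta> M"
  obtains C l w where "\<Delta> = convex hull C" "reflexive_simplex_data C l w M"
proof -
  have refl: "reflexive_pair \<Delta> M" and "int DIM('a) simplex \<Delta>"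
    using assms by (auto simp: reflexive_simplex_def)
  then obtain C where C: "\<not> affine_dependent C" "\<Delta> = convex hull C"
    by (auto simp: simplex_def)
  have finC: "finite C"
    using C(1) by (rule aff_independent_finite)
  have int0: "0 \<in> interior (convex hull C)"
    using refl C(2) by (simp add: reflexive_pair_def)
  then obtain w where w: "\<forall>p\<in>C. 0 < w p" "sum w C = 1" "(\<Sum>p\<in>C. w p *\<^sub>R p) = 0"
    by (auto simp: interior_convex_hull_explicit_minimal[OF C(1)] split: if_splits)
  have "interior (span C) \<noteq> {}"
    using int0 interior_mono[OF convex_hull_subset_span[of C]] by auto
  then have span: "span C = UNIV"
    using empty_interior_lowdim[of "span C"] dim_eq_full[of C] dim_subset_UNIV[of C]
    by (auto simp: le_less)
  have "\<exists>n. primitive_in (dual_lattice M) n \<and>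
      (C - {p} \<noteq> {} \<longrightarrow> affine hull (convex hull (C - {p})) = {x. x \<bullet> n = -1})"
    if "p \<in> C" for p
  proof -
    \<comment> \<open>The simplex has at least two vertices because the space has positive dimension.\<close>
    have "C \<noteq> {p}"
      using int0 by auto
    then have "C - {p} \<noteq> {}"
      using that by auto
    then have "convex hull (C - {p}) facet_of \<Delta>"
      using that C by (auto simp: facet_of_convex_hull_affine_independent)
    then show ?thesis
      by (rule reflexive_facet_normal[OF refl]) blast
  qed
  then have "\<exists>l. \<forall>p\<in>C. primitive_in (dual_lattice M) (l p) \<and>
      (C - {p} \<noteq> {} \<longrightarrow> affine hull (convex hull (C - {p})) = {x. x \<bullet> l p = -1})"
    by (intro bchoice) blast
  then obtain l where l: "\<And>p. p \<in> C \<Longrightarrow> primitive_in (dual_lattice M) (l p)"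
      "\<And>p. p \<in> C \<Longrightarrow> C - {p} \<noteq> {} \<Longrightarrow>
        affine hull (convex hull (C - {p})) = {x. x \<bullet> l p = -1}"
    by blast
  have "q \<bullet> l p = -1" if "p \<in> C" "q \<in> C" "q \<noteq> p" for p q
  proof -
    have "q \<in> affine hull (convex hull (C - {p}))"
      using that by (simp add: hull_inc)
    then show ?thesis
      using l(2)[of p] that by auto
  qed
  then have "reflexive_simplex_data C l w M"
    using C refl finC span w l by unfold_locales auto
  then show ?thesis
    using that C(2) by blast
qed

theorem corollary5p4p6:
  fixes \<Delta> M :: "'a::euclidean_space set"
  assumes "reflexive_simplex \<Delta> M"
  shows "selfdual \<Delta> M"
proof -
  obtain C l w where "\<Delta> = convex hull C" "reflexive_simplex_data C l w M"
    using assms by (rule reflexive_simplex_normal_form)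
  then show ?thesis
    using reflexive_simplex_data.selfdual_simplex by blast
qed

end
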